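(* Let $I=[-1,1]$ and $r\ge 1$, let $C(I)$ carry the sup-norm $\|f\|=\sup_{x\in I}|f(x)|$, and let the space $\mathbb{P}_{r-1}\subset C(I)$ of polynomials of degree at most $r-1$ be endowed with the same norm. Let $\mathcal{A}=\{a_1,\dots,a_r\}$ be a set of $r$ supports (nodes and/or segments) in $I$ that is unisolvent for $\mathbb{P}_{r-1}$, with normalized Lagrange basis polynomials $\ell_{a_1},\dots,\ell_{a_r}$, interpolation operator $\Pi_r(\mathcal{A}):C(I)\to\mathbb{P}_{r-1}$ and Lebesgue constant $\Lambda_r(\mathcal{A})$. Then $$\|\Pi_r(\mathcal{A})\|_{\mathrm{op}}\le \Lambda_r(\mathcal{A}).$$ If moreover $\mathcal{A}$ is regular, then $$\|\Pi_r(\mathcal{A})\|_{\mathrm{op}}=\Lambda_r(\mathcal{A}).$$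
   Context: A support $a$ in $I=[-1,1]$ is either a single node $a\in I$ (with length $|a|=0$) or a segment $a=[\alpha,\beta]\subset I$ of positive length $|a|=\beta-\alpha>0$. For a node $a$, the expression $\frac{1}{|a|}\int_a f(x)\,dx$ denotes the point evaluation $f(a)$. A set $\mathcal{A}=\{a_1,\dots,a_r\}$ of $r$ supports is unisolvent for $\mathbb{P}_{r-1}$ if for every prescribed data there is a unique $p\in\mathbb{P}_{r-1}$ with these values of $\frac{1}{|a_i|}\int_{a_i}p(x)\,dx$, $i=1,\dots,r$. In that case the normalized Lagrange basis polynomials $\ell_{a_j}\in\mathbb{P}_{r-1}$ are determined by $\frac{1}{|a_i|}\int_{a_i}\ell_{a_j}(x)\,dx=\delta_{i,j}$. The interpolation operator is $\Pi_r(\mathcal{A})f(x)=\sum_{i=1}^r\left(\frac{1}{|a_i|}\int_{a_i}f(x)\,dx\right)\ell_{a_i}(x)$ for $f\in C(I)$, and $\|\Pi_r(\mathcal{A})\|_{\mathrm{op}}=\sup_{\|f\|=1}\|\Pi_r(\mathcal{A})f\|$. The Lebesgue constant is $\Lambda_r(\mathcal{A})=\sup_{x\in I}\sum_{i=1}^r|\ell_{a_i}(x)|$ (equivalently $\sup_{s\subset I}\frac{1}{|s|}\sum_{i=1}^r\left|\int_s\ell_{a_i}(x)\,dx\right|$, the supremum being over segments $s$). $\mathcal{A}$ is regular if it splits as $\mathcal{A}=\mathcal{X}\cup\mathcal{S}$ where (i) $\mathcal{X}$ consists of pairwise distinct nodes; (ii) $\mathcal{S}$ consists of segments that overlap at most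 in their endpoints; (iii) no point of $\mathcal{X}$ lies in the interior of an element of $\mathcal{S}$. *)

theory Defs
  imports "HOL-Analysis.Analysis" "HOL-Computational_Algebra.Polynomial"
begin

abbreviation I :: "real set" where
  "I \<equiv> {-1..1}"

datatype support = Node real | Segment real real

fun points :: "support \<Rightarrow> real set" where
  "points (Node x) = {x}"
| "points (Segment \<alpha> \<beta>) = {\<alpha>..\<beta>}"

fun endpoints :: "support \<Rightarrow> real set" where
  "endpoints (Node x) = {x}"
| "endpoints (Segment \<alpha> \<beta>) = {\<alpha>, \<beta>}"

definition nodes :: "support set" where
  "nodes = {Node x | x. x \<in> I}"

definition segments :: "support set" where
  "segments = {Segment \<alpha> \<beta> | \<alpha> \<beta>. \<alpha> < \<beta> \<and> {\<alpha>..\<beta>} \<subseteq> I}"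

text \<open>The normalized integral over a support.\<close>

fun avg :: "support \<Rightarrow> (real \<Rightarrow> real) \<Rightarrow> real" where
  "avg (Node x) f = f x"
| "avg (Segment \<alpha> \<beta>) f = 1 / (\<beta> - \<alpha>) * integral {\<alpha>..\<beta>} f"

definition poly_space :: "nat \<Rightarrow> real poly set" where
  "poly_space n = {p. degree p \<le> n}"

definition unisolvent :: "nat \<Rightarrow> support set \<Rightarrow> bool" where
  "unisolvent r A \<longleftrightarrow>
     (\<forall>y :: support \<Rightarrow> real. \<exists>!p. p \<in> poly_space (r - 1) \<and> (\<forall>a\<in>A. avg a (poly p) = y a))"

text \<open>Only meaningful if \<^term>\<open>unisolvent r A\<close> holds and \<open>a \<in> A\<close>;
  the description operator then selects the unique polynomial.\<close>

definition lagrange :: "nat \<Rightarrow> support set \<Rightarrow> support \<Rightarrow> real poly" where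
  "lagrange r A a =
     (THE p. p \<in> poly_space (r - 1) \<and> (\<forall>b\<in>A. avg b (poly p) = (if b = a then 1 else 0)))"

definition interp :: "nat \<Rightarrow> support set \<Rightarrow> (real \<Rightarrow> real) \<Rightarrow> real poly" where
  "interp r A f = (\<Sum>a\<in>A. smult (avg a f) (lagrange r A a))"

text \<open>Elements of \<open>C(I)\<close> are represented by total functions that are continuous on \<open>I\<close>; their
  values outside \<open>I\<close> play no role.  The suprema below are suprema of real sets, hence
  meaningful for nonempty sets that are bounded above.  Boundedness of those used here is
  shown in \<open>bdd_above_lebesgue\<close> and \<open>bdd_above_interp\<close>.\<close>

definition sup_norm :: "(real \<Rightarrow> real) \<Rightarrow> real" where
  "sup_norm f = (SUP x\<in>I. \<bar>f x\<bar>)"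

definition op_norm :: "((real \<Rightarrow> real) \<Rightarrow> (real \<Rightarrow> real)) \<Rightarrow> real" where
  "op_norm T = (SUP f\<in>{f. continuous_on I f \<and> sup_norm f = 1}. sup_norm (T f))"

definition lebesgue_const :: "nat \<Rightarrow> support set \<Rightarrow> real" where
  "lebesgue_const r A = (SUP x\<in>I. \<Sum>a\<in>A. \<bar>poly (lagrange r A a) x\<bar>)"

text \<open>Pairwise distinctness of the nodes is implicit in \<open>X\<close> being a set.\<close>

definition regular :: "support set \<Rightarrow> bool" where
  "regular A \<longleftrightarrow> (\<exists>X S. A = X \<union> S \<and> X \<subseteq> nodes \<and> S \<subseteq> segments \<and>
     (\<forall>s\<in>S. \<forall>t\<in>S. s \<noteq> t \<longrightarrow> points s \<inter> points t \<subseteq> endpoints s \<inter> endpoints t) \<and>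
     (\<forall>x. Node x \<in> X \<longrightarrow> (\<forall>s\<in>S. x \<notin> interior (points s))))"

lemma bdd_above_abs_continuous:
  fixes f :: "real \<Rightarrow> real"
  assumes "continuous_on I f"
  shows "bdd_above ((\<lambda>x. \<bar>f x\<bar>) ` I)"
proof -
  have "compact ((\<lambda>x. \<bar>f x\<bar>) ` I)"
    by (intro compact_continuous_image continuous_on_rabs assms compact_Icc)
  then show ?thesis by (simp add: compact_imp_bounded bounded_imp_bdd_above)
qed

lemma abs_le_sup_norm:
  assumes "continuous_on I f" "x \<in> I"
  shows "\<bar>f x\<bar> \<le> sup_norm f"
  unfolding sup_norm_def by (rule cSUP_upper[OF assms(2) bdd_above_abs_continuous[OF assms(1)]])

lemma bdd_above_lebesgue: "bdd_above ((\<lambda>x. \<Sum>a\<in>A. \<bar>poly (lagrange r A a) x\<bar>) ` I)"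
proof -
  have "compact ((\<lambda>x. \<Sum>a\<in>A. \<bar>poly (lagrange r A a) x\<bar>) ` I)"
    by (intro compact_continuous_image continuous_intros compact_Icc)
  then show ?thesis by (simp add: compact_imp_bounded bounded_imp_bdd_above)
qed

lemma abs_avg_le_sup_norm:
  assumes f: "continuous_on I f" and a: "a \<in> nodes \<union> segments"
  shows "\<bar>avg a f\<bar> \<le> sup_norm f"
proof (cases a)
  case (Node x)
  then show ?thesis using a abs_le_sup_norm[OF f] by (auto simp: nodes_def segments_def)
next
  case (Segment \<alpha> \<beta>)
  then have *: "\<alpha> < \<beta>" "{\<alpha>..\<beta>} \<subseteq> I" using a by (auto simp: nodes_def segments_def)
  then have c: "continuous_on {\<alpha>..\<beta>} f" using f continuous_on_subset by blast
  have "norm (integral {\<alpha>..\<beta>} f) \<le> sup_norm f * (\<beta> - \<alpha>)"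
    using * by (intro integral_bound c) (auto simp: subset_iff intro!: abs_le_sup_norm[OF f])
  then show ?thesis using * Segment by (simp add: abs_mult field_simps)
qed

lemma sup_norm_interp_le:
  assumes "A \<subseteq> nodes \<union> segments" "continuous_on I f" "sup_norm f = 1"
  shows "sup_norm (poly (interp r A f)) \<le> lebesgue_const r A"
  unfolding sup_norm_def
proof (rule cSUP_least)
  fix x :: real assume x: "x \<in> I"
  have "\<bar>poly (interp r A f) x\<bar> \<le> (\<Sum>a\<in>A. \<bar>avg a f * poly (lagrange r A a) x\<bar>)"
    by (simp add: interp_def poly_sum sum_abs)
  also have "\<dots> \<le> (\<Sum>a\<in>A. \<bar>poly (lagrange r A a) x\<bar>)"
    using assms abs_avg_le_sup_norm[OF assms(2)]
    by (intro sum_mono) (auto simp: abs_mult intro!: mult_left_le_one_le)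
  also have "\<dots> \<le> lebesgue_const r A"
    unfolding lebesgue_const_def by (rule cSUP_upper[OF x bdd_above_lebesgue])
  finally show "\<bar>poly (interp r A f) x\<bar> \<le> lebesgue_const r A" .
qed simp

lemma bdd_above_interp:
  assumes "A \<subseteq> nodes \<union> segments"
  shows "bdd_above ((\<lambda>f. sup_norm (poly (interp r A f))) `
           {f. continuous_on I f \<and> sup_norm f = 1})"
  using sup_norm_interp_le[OF assms] by (intro bdd_aboveI2) auto

end

theory Submission
  imports Defs
begin

text \<open>
  Only the lower bound in the regular case needs work. Fix \<open>x\<close> in \<open>I\<close> and
  let \<open>e a\<close> be the sign of the basis polynomial of \<open>a\<close> at \<open>x\<close>. Nodes and interiors of segments of
  a regular set are pairwise disjoint, so there is a function bounded by 1 that equals \<open>e a\<close>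
  on each of them. It is a pointwise limit of continuous functions \<open>f n\<close> bounded by 1, and by
  dominated convergence the averages of \<open>f n\<close> over \<open>a\<close> tend to \<open>e a\<close>. Hence the interpolants of
  \<open>f n\<close> at \<open>x\<close> tend to the value of the Lebesgue function there.
\<close>

text \<open>Endpoints of a segment are dropped because a neighbouring segment may share them and a
  node may sit there. A point is all a node has, so it is kept.\<close>

fun core :: "support \<Rightarrow> real set" where
  "core (Node x) = {x}"
| "core (Segment \<alpha> \<beta>) = {\<alpha><..<\<beta>}"

text \<open>For positive \<open>n\<close>: a tent of half-width 1/n around a node, and a plateau
  with ramps of slope \<open>n\<close> lying inside the segment. The ramps vanish at both ends, so
  the limit is the indicator of the open interval.\<close>

fun bump :: "nat \<Rightarrow> support \<Rightarrow> real \<Rightarrow> real" where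
  "bump n (Node c) x = max 0 (1 - real n * \<bar>x - c\<bar>)"
| "bump n (Segment \<alpha> \<beta>) x = min 1 (real n * max 0 (min (x - \<alpha>) (\<beta> - x)))"

lemma regular_core_disjoint:
  assumes "regular A" "a \<in> A" "b \<in> A" "a \<noteq> b"
  shows "core a \<inter> core b = {}"
proof -
  obtain X S where A: "A = X \<union> S" and X: "X \<subseteq> nodes" and S: "S \<subseteq> segments"
    and ov: "\<forall>s\<in>S. \<forall>t\<in>S. s \<noteq> t \<longrightarrow> points s \<inter> points t \<subseteq> endpoints s \<inter> endpoints t"
    and nd: "\<forall>x. Node x \<in> X \<longrightarrow> (\<forall>s\<in>S. x \<notin> interior (points s))"
    using assms(1) unfolding regular_def by (elim exE conjE)
  \<comment> \<open>The splitting into \<open>X\<close> and \<open>S\<close> is only known to exist,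
    but the constructor of a support decides which part contains it.\<close>
  have memX: "Node x \<in> X" if "Node x \<in> A" for x
    using that S unfolding A segments_def by blast
  have memS: "Segment \<alpha> \<beta> \<in> S" if "Segment \<alpha> \<beta> \<in> A" for \<alpha> \<beta>
    using that X unfolding A nodes_def by blast
  show ?thesis
  proof (cases a)
    case a: (Node x)
    show ?thesis
    proof (cases b)
      case (Node y)
      then show ?thesis using a assms(4) by auto
    next
      case (Segment \<alpha> \<beta>)
      then show ?thesis using a nd memX[of x] memS[of \<alpha> \<beta>] assms by fastforce
    qed
  next
    case a: (Segment \<gamma> \<delta>)
    show ?thesis
    proof (cases b)
      case (Node y)
      then show ?thesis using a nd memX[of y] memS[of \<gamma> \<delta>] assms by fastforce
    next
      case b: (Segment \<alpha> \<beta>)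
      \<comment> \<open>A point common to two open intervals would have to be an endpoint of
        \<open>a\<close>, which \<open>core a\<close> excludes.\<close>
      have "core a \<inter> core b \<subseteq> points a \<inter> points b" using a b by auto
      also have "\<dots> \<subseteq> endpoints a" using ov memS[of \<gamma> \<delta>] memS[of \<alpha> \<beta>] a b assms by blast
      finally show ?thesis using a by auto
    qed
  qed
qed

lemma continuous_on_bump: "continuous_on T (bump n a)"
  by (cases a) (auto intro!: continuous_intros simp: bump.simps[abs_def])

text \<open>At each point the sequence is eventually constant: once \<open>n\<close> times the
  relevant positive distance \<open>d\<close> reaches 1, the tent has dropped to 0 or the ramp has
  reached 1.\<close>

lemma bump_tendsto: "(\<lambda>n. bump n a x) \<longlonglongrightarrow> indicator (core a) x"
proof -
  have ev: "\<forall>\<^sub>F n in sequentially. 1 \<le> real n * d" if "d > 0" for d :: real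
  proof -
    have "filterlim (\<lambda>n. real n * d) at_top sequentially"
      using that by (intro filterlim_at_top_mult_tendsto_pos[OF tendsto_const _ filterlim_real_sequentially])
    then show ?thesis unfolding filterlim_at_top by blast
  qed
  show ?thesis
  proof (cases a)
    case (Node c)
    show ?thesis
    proof (cases "x = c")
      case False
      then have "\<forall>\<^sub>F n in sequentially. bump n a x = 0"
        using ev[of "\<bar>x - c\<bar>"] Node by (auto elim: eventually_mono)
      then show ?thesis using False Node by (simp add: tendsto_eventually)
    qed (simp add: Node)
  next
    case (Segment \<alpha> \<beta>)
    show ?thesis
    proof (cases "x \<in> core a")
      case True
      then have d: "0 < min (x - \<alpha>) (\<beta> - x)" using Segment by simp
      have "\<forall>\<^sub>F n in sequentially. bump n a x = 1"
        using ev[OF d] by (rule eventually_mono) (use d Segment in \<open>simp add: max_def\<close>)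
      then show ?thesis using True by (simp add: tendsto_eventually)
    next
      case False
      then have "max 0 (min (x - \<alpha>) (\<beta> - x)) = 0" using Segment by auto
      then have "bump n a x = 0" for n using Segment by simp
      then show ?thesis using False by simp
    qed
  qed
qed

lemma avg_tendsto_core:
  fixes f :: "nat \<Rightarrow> real \<Rightarrow> real"
  assumes a: "a \<in> nodes \<union> segments"
    and cont: "\<And>n. continuous_on I (f n)" and bd: "\<And>n x. \<bar>f n x\<bar> \<le> 1"
    and lim: "\<And>x. (\<lambda>n. f n x) \<longlonglongrightarrow> g x" and g: "\<And>x. x \<in> core a \<Longrightarrow> g x = c"
  shows "(\<lambda>n. avg a (f n)) \<longlonglongrightarrow> c"
proof (cases a)
  case (Node x)
  then show ?thesis using lim[of x] g by simp
next
  case (Segment \<alpha> \<beta>)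
  then have *: "\<alpha> < \<beta>" "{\<alpha>..\<beta>} \<subseteq> I" using a by (auto simp: nodes_def segments_def)
  have "(\<lambda>n. integral {\<alpha>..\<beta>} (f n)) \<longlonglongrightarrow> integral {\<alpha>..\<beta>} g"
  proof (rule dominated_convergence(2)[where h = "\<lambda>_. 1"])
    show "f n integrable_on {\<alpha>..\<beta>}" for n
      using cont * by (intro integrable_continuous_real) (rule continuous_on_subset)
  qed (use bd lim in auto)
  \<comment> \<open>The limit \<open>g\<close> is not controlled at the two endpoints, but they form
    a null set.\<close>
  also have "integral {\<alpha>..\<beta>} g = integral {\<alpha>..\<beta>} (\<lambda>_. c)"
    by (rule integral_spike[of "{\<alpha>, \<beta>}"]) (use g Segment in auto)
  finally have "(\<lambda>n. 1 / (\<beta> - \<alpha>) * integral {\<alpha>..\<beta>} (f n)) \<longlonglongrightarrow> 1 / (\<beta> - \<alpha>) * ((\<beta> - \<alpha>) * c)"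
    using * by (intro tendsto_mult_left) simp
  then show ?thesis using * Segment by simp
qed

lemma regular_sign_approximation:
  fixes e :: "support \<Rightarrow> real"
  assumes A: "A \<subseteq> nodes \<union> segments" "finite A" "regular A"
    and e: "\<And>a. a \<in> A \<Longrightarrow> \<bar>e a\<bar> \<le> 1"
  obtains f :: "nat \<Rightarrow> real \<Rightarrow> real"
  where "\<And>n. continuous_on I (f n)" "\<And>n x. \<bar>f n x\<bar> \<le> 1"
    "\<And>a. a \<in> A \<Longrightarrow> (\<lambda>n. avg a (f n)) \<longlonglongrightarrow> e a"
proof
  \<comment> \<open>Bumps of different supports may overlap for a fixed \<open>n\<close>, so their
    weighted sum can leave [-1,1]. Clamping restores the bound, is continuous and hence respects
    limits, and fixes every \<open>e a\<close>.\<close>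
  define clamp :: "real \<Rightarrow> real" where "clamp y = max (- 1) (min 1 y)" for y
  define f where "f n x = clamp (\<Sum>a\<in>A. e a * bump n a x)" for n x
  define g where "g x = clamp (\<Sum>a\<in>A. e a * indicator (core a) x)" for x
  show cont: "continuous_on I (f n)" for n
    unfolding f_def clamp_def by (intro continuous_intros continuous_on_bump)
  show bd: "\<bar>f n x\<bar> \<le> 1" for n x by (auto simp: f_def clamp_def)
  have lim: "(\<lambda>n. f n x) \<longlonglongrightarrow> g x" for x
    unfolding f_def g_def clamp_def by (intro tendsto_intros bump_tendsto)
  have g: "g x = e a" if "a \<in> A" "x \<in> core a" for a x
  proof -
    \<comment> \<open>Since the cores are disjoint, only the term of \<open>a\<close> survives at a
      point of \<open>core a\<close>.\<close>
    have "(\<Sum>b\<in>A. e b * indicator (core b) x) = (\<Sum>b\<in>A. if b = a then e a else 0)"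
      using that regular_core_disjoint[OF A(3) that(1)]
      by (intro sum.cong) (auto simp: indicator_def)
    then show ?thesis using e[OF that(1)] that A(2) by (auto simp: g_def clamp_def)
  qed
  show "(\<lambda>n. avg a (f n)) \<longlonglongrightarrow> e a" if "a \<in> A" for a
    by (rule avg_tendsto_core[OF _ cont bd lim g]) (use that A in auto)
qed

lemma avg_scale: "avg a (\<lambda>x. c * f x) = c * avg a f"
  by (cases a) auto

lemma poly_interp_scale: "poly (interp r A (\<lambda>x. c * f x)) y = c * poly (interp r A f) y"
  by (simp add: interp_def avg_scale poly_sum sum_distrib_left mult.assoc)

lemma sup_norm_scale:
  assumes "continuous_on I f" "c \<ge> 0"
  shows "sup_norm (\<lambda>x. c * f x) = c * sup_norm f"
proof (rule antisym)
  show "sup_norm (\<lambda>x. c * f x) \<le> c * sup_norm f"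
    unfolding sup_norm_def[of "\<lambda>x. c * f x"]
    using assms abs_le_sup_norm[OF assms(1)]
    by (intro cSUP_least) (auto simp: abs_mult intro: mult_left_mono)
next
  show "c * sup_norm f \<le> sup_norm (\<lambda>x. c * f x)"
  proof (cases "c = 0")
    case False
    have "sup_norm f \<le> sup_norm (\<lambda>x. c * f x) / c"
      unfolding sup_norm_def[of f]
    proof (rule cSUP_least)
      fix x :: real assume "x \<in> I"
      then have "\<bar>c * f x\<bar> \<le> sup_norm (\<lambda>x. c * f x)"
        using assms by (intro abs_le_sup_norm continuous_intros)
      then show "\<bar>f x\<bar> \<le> sup_norm (\<lambda>x. c * f x) / c"
        using False assms(2) by (simp add: abs_mult field_simps)
    qed simp
    then show ?thesis using False assms(2) by (simp add: field_simps)
  qed (simp add: sup_norm_def)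
qed

lemma sup_norm_nonneg: "continuous_on I f \<Longrightarrow> sup_norm f \<ge> 0"
  using abs_le_sup_norm[of f 0] by simp

lemma sup_norm_interp_le_op_norm:
  assumes "A \<subseteq> nodes \<union> segments" "continuous_on I f" "sup_norm f = 1"
  shows "sup_norm (poly (interp r A f)) \<le> op_norm (\<lambda>f. poly (interp r A f))"
  unfolding op_norm_def using assms by (intro cSUP_upper bdd_above_interp) auto

text \<open>The operator norm is a supremum over functions of norm exactly 1, while the approximants
  only have norm at most 1. Normalizing \<open>f\<close> by homogeneity bridges the gap.\<close>

lemma abs_interp_le_op_norm:
  assumes A: "A \<subseteq> nodes \<union> segments" and f: "continuous_on I f" and x: "x \<in> I"
  shows "\<bar>poly (interp r A f) x\<bar> \<le> op_norm (\<lambda>f. poly (interp r A f)) * sup_norm f"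
proof (cases "sup_norm f = 0")
  case True
  \<comment> \<open>Normalization is impossible here, but averages are bounded by the norm, so the
    interpolant is zero.\<close>
  then have "avg a f = 0" if "a \<in> A" for a
    using abs_avg_le_sup_norm[OF f, of a] that A by auto
  then show ?thesis using True by (simp add: interp_def)
next
  case False
  define M where "M = sup_norm f"
  have M: "M > 0" using False sup_norm_nonneg[OF f] by (simp add: M_def)
  define h where "h x = inverse M * f x" for x
  have h: "continuous_on I h" "sup_norm h = 1"
    using f sup_norm_scale[OF f, of "inverse M"] M
    by (auto simp: h_def[abs_def] M_def intro!: continuous_intros)
  have "f = (\<lambda>x. M * h x)" using M by (auto simp: h_def)
  then have "\<bar>poly (interp r A f) x\<bar> = M * \<bar>poly (interp r A h) x\<bar>"
    using M by (simp add: poly_interp_scale abs_mult)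
  also have "\<bar>poly (interp r A h) x\<bar> \<le> sup_norm (poly (interp r A h))"
    using x by (intro abs_le_sup_norm continuous_intros)
  also have "\<dots> \<le> op_norm (\<lambda>f. poly (interp r A f))"
    using sup_norm_interp_le_op_norm[OF A h] .
  finally show ?thesis using M by (simp add: M_def mult.commute)
qed

lemma sup_norm_one: "sup_norm (\<lambda>_. 1) = 1"
  by (simp add: sup_norm_def)

lemma op_norm_interp_nonneg:
  assumes "A \<subseteq> nodes \<union> segments"
  shows "op_norm (\<lambda>f. poly (interp r A f)) \<ge> 0"
proof -
  have "0 \<le> sup_norm (poly (interp r A (\<lambda>_. 1)))"
    by (intro sup_norm_nonneg continuous_intros)
  also have "\<dots> \<le> op_norm (\<lambda>f. poly (interp r A f))"
    using assms sup_norm_one by (intro sup_norm_interp_le_op_norm) auto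
  finally show ?thesis .
qed

lemma op_norm_interp_le_lebesgue_const:
  assumes "A \<subseteq> nodes \<union> segments"
  shows "op_norm (\<lambda>f. poly (interp r A f)) \<le> lebesgue_const r A"
  unfolding op_norm_def
proof (rule cSUP_least)
  \<comment> \<open>A real supremum is bounded this way only over a nonempty set; the constant 1 is
    a witness.\<close>
  have "(\<lambda>_. 1) \<in> {f. continuous_on I f \<and> sup_norm f = 1}" by (simp add: sup_norm_one)
  then show "{f. continuous_on I f \<and> sup_norm f = 1} \<noteq> {}" by blast
qed (use sup_norm_interp_le[OF assms] in auto)

lemma lebesgue_const_le_op_norm_interp:
  assumes A: "A \<subseteq> nodes \<union> segments" "finite A" "regular A"
  shows "lebesgue_const r A \<le> op_norm (\<lambda>f. poly (interp r A f))"
  unfolding lebesgue_const_def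
proof (rule cSUP_least)
  fix x :: real assume x: "x \<in> I"
  define e where "e a = sgn (poly (lagrange r A a) x)" for a
  have "\<bar>e a\<bar> \<le> 1" for a by (auto simp: e_def sgn_if)
  then obtain f where cont: "\<And>n. continuous_on I (f n)" and bd: "\<And>n x. \<bar>f n x\<bar> \<le> 1"
    and lim: "\<And>a. a \<in> A \<Longrightarrow> (\<lambda>n. avg a (f n)) \<longlonglongrightarrow> e a"
    using regular_sign_approximation[OF A, of e] by blast
  have "(\<lambda>n. poly (interp r A (f n)) x) \<longlonglongrightarrow> (\<Sum>a\<in>A. e a * poly (lagrange r A a) x)"
    unfolding interp_def poly_sum poly_smult by (intro tendsto_intros lim)
  \<comment> \<open>Multiplying a real by its sign gives its absolute value, also at zeros of a
    basis polynomial, where the sign is 0.\<close>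
  then have "(\<lambda>n. poly (interp r A (f n)) x) \<longlonglongrightarrow> (\<Sum>a\<in>A. \<bar>poly (lagrange r A a) x\<bar>)"
    by (simp add: e_def sgn_mult_self_eq linordered_idom_class.abs_sgn mult.commute)
  moreover have "poly (interp r A (f n)) x \<le> op_norm (\<lambda>f. poly (interp r A f))" for n
  proof -
    have "sup_norm (f n) \<le> 1"
      unfolding sup_norm_def by (rule cSUP_least) (use bd in auto)
    \<comment> \<open>Replacing \<open>sup_norm (f n)\<close> by its bound 1 needs the operator norm
      to be nonnegative.\<close>
    then have "op_norm (\<lambda>f. poly (interp r A f)) * sup_norm (f n) \<le> op_norm (\<lambda>f. poly (interp r A f))"
      using op_norm_interp_nonneg[OF A(1)] by (simp add: mult_left_le)
    then show ?thesis using abs_interp_le_op_norm[OF A(1) cont x, of r n] by linarith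
  qed
  ultimately show "(\<Sum>a\<in>A. \<bar>poly (lagrange r A a) x\<bar>) \<le> op_norm (\<lambda>f. poly (interp r A f))"
    by (auto intro: LIMSEQ_le_const2)
qed simp

theorem theorem5:
  fixes r :: nat and A :: "support set"
  assumes "r \<ge> 1"
    and "A \<subseteq> nodes \<union> segments"
    and "finite A" and "card A = r"
    and "unisolvent r A"
  shows "op_norm (\<lambda>f. poly (interp r A f)) \<le> lebesgue_const r A \<and>
    (regular A \<longrightarrow> op_norm (\<lambda>f. poly (interp r A f)) = lebesgue_const r A)"
  using op_norm_interp_le_lebesgue_const[OF assms(2)]
    lebesgue_const_le_op_norm_interp[OF assms(2,3)]
  by (auto intro: antisym)

end
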